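(* Let $0<\alpha<1$, $n\ge 1$, $A\in\mathbb{R}^{n\times n}$, $x_0\in\mathbb{R}^n$ and $T>0$, and suppose that the trajectory $x(t)=u(t;x_0)$, $t\ge 0$, is non-constant. Then $x(t)$ has a multiple point at $p=x(T)$ (at time $T$) if and only if $x_0\in\ker\{E_{\alpha,0}(T^\alpha A)\}$ and there exists an eigenvalue $\lambda\in\mathbb{C}$ of $A$ of the form $\lambda=\frac{\eta}{T^\alpha}$, where $\eta\in\mathbb{C}$ is a zero of $E_{\alpha,0}(z)$.
   Context: For $\beta\in\mathbb{R}$ the two-parameter Mittag-Leffler function is $E_{\alpha,\beta}(z)=\sum_{k=0}^{\infty}\frac{z^k}{\Gamma(\alpha k+\beta)}$, $z\in\mathbb{C}$ (with $1/\Gamma$ taken to be $0$ at the poles of $\Gamma$, so for $\beta=0$ the $k=0$ term vanishes), and for a square matrix $M$, $E_{\alpha,\beta}(M)=\sum_{k=0}^\infty\frac{M^k}{\Gamma(\alpha k+\beta)}$; $E_\alpha:=E_{\alpha,1}$. The fractional initial value problem $D^\alpha x(t)=Ax(t)$, $t\ge 0$, $x(0)=x_0$ (Caputo derivative of order $\alpha$) has the unique solution $u(t;x_0):=E_\alpha(t^\alpha A)x_0$, $t\ge 0$, called the trajectory starting at $x_0$. A point $p\in\mathbb{R}^n$ is called a multiple point (point of multiple contact) of a non-constant trajectory $x(t)=u(t;x_0)$, at time $T>0$, if $x(T)=p$ and $\frac{d}{dt}x(t)\big|_{t=T}=0$. *)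

theory Defs
  imports "HOL-Analysis.Analysis"
begin

text \<open>The function \<open>rGamma\<close> is the entire function \<open>1 / Gamma\<close>, with value \<open>0\<close> at the poles of \<open>Gamma\<close>.\<close>

definition mittag_leffler :: "real \<Rightarrow> real \<Rightarrow> complex \<Rightarrow> complex"
  where "mittag_leffler \<alpha> \<beta> z = (\<Sum>k. rGamma (\<alpha> * real k + \<beta>) *\<^sub>R z ^ k)"

text \<open>The overloaded operators \<open>*\<close> and \<open>^\<close> act componentwise on \<open>real^'n^'n\<close>, so powers with
  respect to the matrix product need a definition of their own.\<close>

primrec matrix_power :: "real^'n^'n \<Rightarrow> nat \<Rightarrow> real^'n^'n"
  where
    "matrix_power M 0 = mat 1"
  | "matrix_power M (Suc k) = M ** matrix_power M k"

definition mittag_leffler_matrix :: "real \<Rightarrow> real \<Rightarrow> real^'n^'n \<Rightarrow> real^'n^'n"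
  where "mittag_leffler_matrix \<alpha> \<beta> M = (\<Sum>k. rGamma (\<alpha> * real k + \<beta>) *\<^sub>R matrix_power M k)"

definition matrix_kernel :: "real^'n^'m \<Rightarrow> (real^'n) set"
  where "matrix_kernel M = {v. M *v v = 0}"

definition complex_eigenvalue :: "real^'n^'n \<Rightarrow> complex \<Rightarrow> bool"
  where "complex_eigenvalue A \<mu> \<longleftrightarrow>
    (\<exists>v :: complex^'n. v \<noteq> 0 \<and> map_matrix complex_of_real A *v v = \<mu> *s v)"

definition trajectory :: "real \<Rightarrow> real^'n^'n \<Rightarrow> real^'n \<Rightarrow> real \<Rightarrow> real^'n"
  where "trajectory \<alpha> A x0 t = mittag_leffler_matrix \<alpha> 1 ((t powr \<alpha>) *\<^sub>R A) *v x0"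

text \<open>Trajectories are considered on \<open>{0..}\<close> only; since \<open>T > 0\<close> is an interior point, the
  two-sided derivative at \<open>T\<close> does not depend on values at negative times.\<close>

definition multiple_point :: "(real \<Rightarrow> real^'n) \<Rightarrow> real \<Rightarrow> real^'n \<Rightarrow> bool"
  where "multiple_point x T p \<longleftrightarrow>
    \<not> x constant_on {0..} \<and> T > 0 \<and> x T = p \<and> (x has_vector_derivative 0) (at T)"

end

theory Submission
  imports Defs "HOL-Computational_Algebra.Fundamental_Theorem_Algebra"
begin

text \<open>
  Put \<open>M = T\<^sup>\<alpha> A\<close> and write \<open>E\<^sub>\<beta>\<close> for the Mittag-Leffler function with parameters \<open>\<alpha>\<close> and
  \<open>\<beta>\<close>. Termwise differentiation of the series of the trajectory turns \<open>t\<^sup>\<alpha>\<^sup>k / \<Gamma>(\<alpha>k + 1)\<close> into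
  \<open>\<alpha>k t\<^sup>\<alpha>\<^sup>k / (t \<Gamma>(\<alpha>k + 1)) = t\<^sup>\<alpha>\<^sup>k / (t \<Gamma>(\<alpha>k))\<close>, so that \<open>x'(T) = E\<^sub>0(M) x\<^sub>0 / T\<close>
  (\<open>trajectory_has_vector_derivative\<close>). Hence the derivative at \<open>T\<close> vanishes exactly when
  \<open>x\<^sub>0\<close> lies in the kernel of \<open>E\<^sub>0(M)\<close>.

  The condition on eigenvalues is a consequence of the kernel condition. A non-constant trajectory
  has \<open>x\<^sub>0 \<noteq> 0\<close>, so the complexified kernel of \<open>E\<^sub>0(M)\<close> is not zero. It is invariant under
  \<open>M\<close>, because \<open>E\<^sub>0(M)\<close> commutes with \<open>M\<close>, and therefore contains an eigenvector \<open>w\<close> of \<open>M\<close>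
  (\<open>ex_eigenvector_in_invariant_subspace\<close>). If \<open>\<eta>\<close> is its eigenvalue, then
  \<open>0 = E\<^sub>0(M) w = E\<^sub>0(\<eta>) w\<close> (\<open>mittag_leffler_matrix_eigenvector\<close>), so \<open>\<eta>\<close> is a zero of \<open>E\<^sub>0\<close>
  and \<open>\<eta> / T\<^sup>\<alpha>\<close> is an eigenvalue of \<open>A\<close>.

  All series converge because \<open>1 / \<Gamma>(\<alpha>k + \<beta>)\<close> decays faster than any geometric sequence
  (\<open>summable_rGamma_power\<close>).
\<close>

section \<open>Decay of the Mittag-Leffler coefficients\<close>

text \<open>In Euler's integral for \<open>\<Gamma>(x)\<close>, only the piece over \<open>[R, R + 1]\<close> is kept. As \<open>R\<close> is arbitrary,
  this shows that \<open>\<Gamma>\<close> grows faster than any exponential, without an appeal to Stirling's formula.\<close>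

lemma Gamma_real_ge_powr:
  fixes x R :: real
  assumes "x \<ge> 1" and "R > 0"
  shows "R powr (x - 1) * exp (- (R + 1)) \<le> Gamma x"
proof -
  let ?f = "\<lambda>t::real. t powr (x - 1) / exp t"
  have Gamma: "(?f has_integral Gamma x) {0..}"
    using assms by (intro Gamma_integral_real) auto
  have "continuous_on {R..R+1} ?f"
    using assms by (intro continuous_intros) auto
  then have f_int: "(?f has_integral integral {R..R+1} ?f) {R..R+1}"
    by (intro integrable_integral integrable_continuous_real)
  have "((\<lambda>t. R powr (x - 1) * exp (- (R + 1))) has_integral
      R powr (x - 1) * exp (- (R + 1))) {R..R+1}"
    using has_integral_const_real[of "R powr (x - 1) * exp (- (R + 1))" R "R + 1"] by simp
  then have "R powr (x - 1) * exp (- (R + 1)) \<le> integral {R..R+1} ?f"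
  proof (rule has_integral_le[OF _ f_int])
    fix t assume t: "t \<in> {R..R+1}"
    then have "R powr (x - 1) * exp (- (R + 1)) \<le> t powr (x - 1) * exp (- t)"
      using assms by (intro mult_mono powr_mono2) auto
    then show "R powr (x - 1) * exp (- (R + 1)) \<le> ?f t"
      by (simp add: exp_minus divide_inverse)
  qed
  also have "\<dots> \<le> Gamma x"
    using assms by (intro has_integral_subset_le[OF _ f_int Gamma]) auto
  finally show ?thesis .
qed

lemma summable_rGamma_power:
  fixes \<alpha> \<beta> r :: real
  assumes "\<alpha> > 0"
  shows "summable (\<lambda>k. \<bar>rGamma (\<alpha> * real k + \<beta>)\<bar> * \<bar>r\<bar> ^ k)"
proof -
  \<comment> \<open>\<open>R\<close> is chosen to make the ratio \<open>\<bar>r\<bar> / R powr \<alpha>\<close> of the majorising geometric series less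
    than \<open>1 / 2\<close>.\<close>
  define R where "R = (2 * \<bar>r\<bar> + 1) powr (1 / \<alpha>)"
  have R: "R > 0" "R powr \<alpha> = 2 * \<bar>r\<bar> + 1"
    using assms by (auto simp: R_def powr_powr)
  define C where "C = exp (R + 1) * R powr (1 - \<beta>)"
  \<comment> \<open>Restricting \<open>k\<close> ensures \<open>\<alpha> k + \<beta> \<ge> 1\<close>, as the lower bound for \<open>\<Gamma>\<close> demands.\<close>
  have bound: "\<bar>rGamma (\<alpha> * real k + \<beta>)\<bar> * \<bar>r\<bar> ^ k \<le> C * (1 / 2) ^ k"
    if "k \<ge> nat \<lceil>(1 - \<beta>) / \<alpha>\<rceil>" for k
  proof -
    let ?x = "\<alpha> * real k + \<beta>"
    have "(1 - \<beta>) / \<alpha> \<le> real k"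
      using that by linarith
    then have x: "?x \<ge> 1"
      using assms by (simp add: field_simps)
    have "R powr (?x - 1) * exp (- (R + 1)) \<le> Gamma ?x"
      by (rule Gamma_real_ge_powr[OF x R(1)])
    moreover have "0 < R powr (?x - 1) * exp (- (R + 1))"
      using R by simp
    ultimately have "0 < Gamma ?x"
        and "inverse (Gamma ?x) \<le> inverse (R powr (?x - 1) * exp (- (R + 1)))"
      by (linarith, rule le_imp_inverse_le)
    then have "\<bar>rGamma ?x\<bar> \<le> inverse (R powr (?x - 1) * exp (- (R + 1)))"
      by (simp only: rGamma_inverse_Gamma abs_of_pos positive_imp_inverse_positive)
    also have "\<dots> = C * inverse ((R powr \<alpha>) ^ k)"
    proof -
      have "R powr (?x - 1) = R powr (\<alpha> * real k) * R powr (- (1 - \<beta>))"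
        by (simp add: powr_add[symmetric] algebra_simps)
      also have "R powr (\<alpha> * real k) = (R powr \<alpha>) ^ k"
        using R by (simp add: powr_powr[symmetric] powr_realpow)
      finally show ?thesis
        by (simp only: C_def powr_minus exp_minus inverse_mult_distrib inverse_inverse_eq)
          (simp add: mult_ac)
    qed
    finally have "\<bar>rGamma ?x\<bar> * \<bar>r\<bar> ^ k \<le> C * inverse ((R powr \<alpha>) ^ k) * \<bar>r\<bar> ^ k"
      by (intro mult_right_mono) auto
    also have "\<dots> = C * (\<bar>r\<bar> / (2 * \<bar>r\<bar> + 1)) ^ k"
      by (simp add: R(2) power_divide) (simp add: field_simps)
    also have "\<dots> \<le> C * (1 / 2) ^ k"
      by (intro mult_left_mono power_mono) (auto simp: C_def field_simps)
    finally show ?thesis .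
  qed
  have "summable (\<lambda>k. C * (1 / 2) ^ k)"
    by (intro summable_mult summable_geometric) simp
  then show ?thesis
    by (rule summable_comparison_test'[where N = "nat \<lceil>(1 - \<beta>) / \<alpha>\<rceil>"]) (use bound in auto)
qed

section \<open>The Mittag-Leffler matrix series\<close>

lemma matrix_add_rdistrib:
  fixes A B :: "'a::semiring_1^'n^'m" and C :: "'a^'k^'n"
  shows "(A + B) ** C = A ** C + B ** C"
  by (simp add: vec_eq_iff matrix_matrix_mult_def distrib_right sum.distrib)

lemma bounded_bilinear_matrix_mult:
  "bounded_bilinear ((**) :: real^'n^'m \<Rightarrow> real^'k^'n \<Rightarrow> real^'k^'m)"
  unfolding bilinear_conv_bounded_bilinear[symmetric]
  by (auto simp: bilinear_def linear_iff matrix_add_ldistrib matrix_add_rdistrib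
      scalar_matrix_assoc matrix_scalar_ac)

lemma norm_matrix_power_le:
  fixes M :: "real^'n^'n"
  obtains C K where "K \<ge> 0" and "\<And>k. norm (matrix_power M k) \<le> C * K ^ k"
proof -
  obtain b where b: "b > 0"
      "\<And>(X :: real^'n^'n) (Y :: real^'n^'n). norm (X ** Y) \<le> norm X * norm Y * b"
    using bounded_bilinear.pos_bounded[OF bounded_bilinear_matrix_mult] by blast
  have "norm (matrix_power M k) \<le> norm (mat 1 :: real^'n^'n) * (norm M * b) ^ k" for k
  proof (induction k)
    case (Suc k)
    have "norm (matrix_power M (Suc k)) \<le> (norm M * b) * norm (matrix_power M k)"
      using b(2)[of M "matrix_power M k"] by (simp add: mult_ac)
    also have "\<dots> \<le> (norm M * b) * (norm (mat 1 :: real^'n^'n) * (norm M * b) ^ k)"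
      using b(1) by (intro mult_left_mono Suc) auto
    finally show ?case by (simp add: mult_ac)
  qed simp
  with b(1) show thesis
    by (intro that[of "norm M * b" "norm (mat 1 :: real^'n^'n)"]) auto
qed

lemma matrix_power_scaleR:
  fixes M :: "real^'n^'n"
  shows "matrix_power (s *\<^sub>R M) k = s ^ k *\<^sub>R matrix_power M k"
  by (induction k) (simp_all add: scalar_matrix_assoc[symmetric] matrix_scalar_ac)

lemma matrix_power_commute:
  fixes M :: "real^'n^'n"
  shows "matrix_power M k ** M = M ** matrix_power M k"
  by (induction k) (simp_all add: matrix_mul_assoc[symmetric])

lemma mittag_leffler_matrix_sums:
  fixes M :: "real^'n^'n"
  assumes "\<alpha> > 0"
  shows "(\<lambda>k. rGamma (\<alpha> * real k + \<beta>) *\<^sub>R matrix_power M k)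
    sums mittag_leffler_matrix \<alpha> \<beta> M"
proof -
  obtain C K where K: "K \<ge> 0" and bound: "\<And>k. norm (matrix_power M k) \<le> C * K ^ k"
    using norm_matrix_power_le[of M] by blast
  have "summable (\<lambda>k. C * (\<bar>rGamma (\<alpha> * real k + \<beta>)\<bar> * \<bar>K\<bar> ^ k))"
    by (intro summable_mult summable_rGamma_power assms)
  then have "summable (\<lambda>k. rGamma (\<alpha> * real k + \<beta>) *\<^sub>R matrix_power M k)"
  proof (rule summable_comparison_test')
    fix k :: nat
    have "norm (rGamma (\<alpha> * real k + \<beta>) *\<^sub>R matrix_power M k)
        \<le> \<bar>rGamma (\<alpha> * real k + \<beta>)\<bar> * (C * K ^ k)"
      by (simp add: mult_left_mono bound)
    then show "norm (rGamma (\<alpha> * real k + \<beta>) *\<^sub>R matrix_power M k)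
        \<le> C * (\<bar>rGamma (\<alpha> * real k + \<beta>)\<bar> * \<bar>K\<bar> ^ k)"
      using K by (simp add: mult_ac)
  qed
  then show ?thesis
    unfolding mittag_leffler_matrix_def by (rule summable_sums)
qed

text \<open>In finite dimension every linear map is continuous, so it may be applied to the series term by
  term. The instances of \<open>L\<close> below are entries of \<open>X x\<^sub>0\<close>, multiplication by a matrix on either
  side, and the action of the complexified matrix on a fixed vector.\<close>

lemma linear_mittag_leffler_matrix_sums:
  fixes M :: "real^'n^'n" and L :: "real^'n^'n \<Rightarrow> 'b::real_normed_vector"
  assumes "\<alpha> > 0" and "linear L"
  shows "(\<lambda>k. rGamma (\<alpha> * real k + \<beta>) *\<^sub>R L (matrix_power M k))
    sums L (mittag_leffler_matrix \<alpha> \<beta> M)"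
  using bounded_linear.sums[OF _ mittag_leffler_matrix_sums[OF assms(1)], of L \<beta> M] assms(2)
  by (simp add: linear_conv_bounded_linear linear_cmul)

lemma mittag_leffler_matrix_commute:
  fixes M :: "real^'n^'n"
  assumes "\<alpha> > 0"
  shows "mittag_leffler_matrix \<alpha> \<beta> M ** M = M ** mittag_leffler_matrix \<alpha> \<beta> M"
proof -
  have "linear (\<lambda>X. X ** M)" "linear (\<lambda>X. M ** X)"
    by (auto simp: linear_iff matrix_add_ldistrib matrix_add_rdistrib
        scalar_matrix_assoc matrix_scalar_ac)
  from this[THEN linear_mittag_leffler_matrix_sums[OF assms], of \<beta> M]
  show ?thesis
    by (auto simp only: matrix_power_commute intro: sums_unique2)
qed

section \<open>The derivative of a trajectory\<close>

text \<open>Each component of the trajectory is a real power series in \<open>s = t\<^sup>\<alpha>\<close>, which is differentiated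
  termwise and composed with \<open>t \<mapsto> t\<^sup>\<alpha>\<close>. The recurrence \<open>z / \<Gamma>(z + 1) = 1 / \<Gamma>(z)\<close> at \<open>z = \<alpha>k\<close>
  absorbs the factor \<open>\<alpha>k\<close> and lowers the second parameter from \<open>1\<close> to \<open>0\<close>.\<close>

lemma trajectory_has_vector_derivative:
  fixes A :: "real^'n^'n"
  assumes "\<alpha> > 0" and "T > 0"
  shows "(trajectory \<alpha> A x0 has_vector_derivative
    (1 / T) *\<^sub>R (mittag_leffler_matrix \<alpha> 0 ((T powr \<alpha>) *\<^sub>R A) *v x0)) (at T)"
proof -
  let ?D = "(1 / T) *\<^sub>R (mittag_leffler_matrix \<alpha> 0 ((T powr \<alpha>) *\<^sub>R A) *v x0)"
  have component: "((\<lambda>t. trajectory \<alpha> A x0 t $ i) has_real_derivative ?D $ i) (at T)" for i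
  proof -
    define a where "a k = (matrix_power A k *v x0) $ i" for k
    define c where "c k = rGamma (\<alpha> * real k + 1) * a k" for k
    have lin: "linear (\<lambda>X::real^'n^'n. (X *v x0) $ i)"
      by (auto simp: linear_iff matrix_vector_mult_add_rdistrib scaleR_matrix_vector_assoc[symmetric])
    have E: "(\<lambda>k. rGamma (\<alpha> * real k + \<beta>) * a k * s ^ k)
        sums (mittag_leffler_matrix \<alpha> \<beta> (s *\<^sub>R A) *v x0) $ i" for s \<beta>
      using linear_mittag_leffler_matrix_sums[OF assms(1) lin, of \<beta> "s *\<^sub>R A"]
      by (simp add: matrix_power_scaleR scaleR_matrix_vector_assoc[symmetric] a_def mult_ac)
    have traj: "trajectory \<alpha> A x0 t $ i = (\<Sum>k. c k * (t powr \<alpha>) ^ k)" for t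
      using E[of 1 "t powr \<alpha>"] by (simp add: trajectory_def c_def sums_unique)
    have "summable (\<lambda>k. c k * s ^ k)" for s
      using E[of 1 s] by (auto simp: c_def dest: sums_summable)
    then have "((\<lambda>s. \<Sum>k. c k * s ^ k) has_real_derivative
        (\<Sum>k. diffs c k * (T powr \<alpha>) ^ k)) (at (T powr \<alpha>))"
      by (rule termdiffs_strong_converges_everywhere)
    from DERIV_chain2[OF this has_real_derivative_powr[OF assms(2)]]
    have deriv: "((\<lambda>t. trajectory \<alpha> A x0 t $ i) has_real_derivative
        (\<Sum>k. diffs c k * (T powr \<alpha>) ^ k) * (\<alpha> * T powr (\<alpha> - 1))) (at T)"
      by (simp add: traj[abs_def])
    have shift: "\<alpha> * diffs c k = rGamma (\<alpha> * real (Suc k)) * a (Suc k)" for k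
      using rGamma_plus1[of "\<alpha> * real (Suc k)"] by (simp add: diffs_def c_def mult_ac)
    \<comment> \<open>Since \<open>rGamma 0 = 0\<close>, the series with second parameter \<open>0\<close> has no constant term, and
      dropping its first term does not change the sum.\<close>
    have "(\<lambda>k. rGamma (\<alpha> * real (Suc k)) * a (Suc k) * (T powr \<alpha>) ^ Suc k)
        sums (T *\<^sub>R ?D $ i)"
      using E[of 0 "T powr \<alpha>"] assms
      by (subst sums_Suc_iff) simp
    moreover have "rGamma (\<alpha> * real (Suc k)) * a (Suc k) * (T powr \<alpha>) ^ Suc k
        = (\<alpha> * T powr \<alpha>) * (diffs c k * (T powr \<alpha>) ^ k)" for k
      unfolding shift[symmetric] by simp
    ultimately have "(\<lambda>k. (\<alpha> * T powr \<alpha>) * (diffs c k * (T powr \<alpha>) ^ k)) sums (T *\<^sub>R ?D $ i)"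
      by (simp only:)
    from sums_divide[OF this, of "\<alpha> * T powr \<alpha>"]
    have "(\<lambda>k. diffs c k * (T powr \<alpha>) ^ k) sums (T * ?D $ i / (\<alpha> * T powr \<alpha>))"
      using assms by simp
    then have "(\<Sum>k. diffs c k * (T powr \<alpha>) ^ k) * (\<alpha> * T powr (\<alpha> - 1)) = ?D $ i"
      using assms by (simp add: sums_iff powr_diff)
    with deriv show ?thesis by simp
  qed
  show ?thesis
    unfolding has_vector_derivative_def
  proof (rule has_derivative_componentwise_within[THEN iffD2], rule ballI)
    fix b :: "real^'n" assume "b \<in> Basis"
    then obtain i where b: "b = axis i 1"
      by (auto simp: Basis_vec_def)
    have "x \<bullet> b = x $ i" for x
      by (simp add: b inner_axis)
    then have "(\<lambda>t. trajectory \<alpha> A x0 t \<bullet> b) = (\<lambda>t. trajectory \<alpha> A x0 t $ i)"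
        and "(\<lambda>h. (h *\<^sub>R ?D) \<bullet> b) = (*) (?D $ i)"
      by (simp_all add: fun_eq_iff)
    with component[of i] show "((\<lambda>t. trajectory \<alpha> A x0 t \<bullet> b) has_derivative
        (\<lambda>h. (h *\<^sub>R ?D) \<bullet> b)) (at T)"
      by (simp only: has_field_derivative_def)
  qed
qed

section \<open>Eigenvectors in invariant subspaces\<close>

text \<open>The vector \<open>p(M) v\<close>, evaluated by Horner's scheme.\<close>

definition poly_act :: "complex^'n^'n \<Rightarrow> complex^'n \<Rightarrow> complex poly \<Rightarrow> complex^'n"
  where "poly_act M v p = fold_coeffs (\<lambda>a w. a *s v + M *v w) p 0"

lemma poly_act_0 [simp]: "poly_act M v 0 = 0"
  by (simp add: poly_act_def)

lemma poly_act_pCons [simp]: "poly_act M v (pCons a p) = a *s v + M *v poly_act M v p"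
  by (cases "p = 0 \<and> a = 0") (auto simp: poly_act_def)

lemma poly_act_add: "poly_act M v (p + q) = poly_act M v p + poly_act M v q"
  by (induction p q rule: poly_induct2)
    (simp_all add: matrix_vector_right_distrib vector_sadd_rdistrib)

lemma poly_act_smult: "poly_act M v (smult c p) = c *s poly_act M v p"
  by (induction p)
    (simp_all add: vector_add_ldistrib vector_smult_assoc vector_scalar_commute[symmetric])

lemma poly_act_sum: "poly_act M v (\<Sum>i\<in>I. p i) = (\<Sum>i\<in>I. poly_act M v (p i))"
  by (induction I rule: infinite_finite_induct) (simp_all add: poly_act_add)

lemma poly_act_monom: "poly_act M v (monom c k) = c *s ((*v) M ^^ k) v"
  by (induction k) (simp_all add: monom_0 monom_Suc vector_scalar_commute)

text \<open>The vectors \<open>v, M v, M\<^sup>2 v, \<dots>\<close> cannot all be independent. Independence is taken over the reals,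
  where the dimension bound of Euclidean spaces applies; the resulting polynomial then has real
  coefficients and a degree up to twice the complex dimension, which is harmless. A repetition among
  the vectors has to be treated apart, because dependence is a property of sets rather than of
  families.\<close>

lemma ex_annihilating_poly:
  fixes M :: "complex^'n^'n"
  obtains p where "p \<noteq> 0" and "poly_act M v p = 0"
proof -
  let ?f = "\<lambda>k. ((*v) M ^^ k) v" and ?d = "DIM(complex^'n)"
  show thesis
  proof (cases "inj_on ?f {..?d}")
    case False
    then obtain i j where ij: "?f i = ?f j" "i \<noteq> j"
      by (auto simp: inj_on_def)
    have "coeff (monom 1 i + monom (- 1) j :: complex poly) i \<noteq> 0"
      using ij by simp
    then have "monom 1 i + monom (- 1) j \<noteq> (0 :: complex poly)"
      by (metis coeff_0)
    moreover have "poly_act M v (monom 1 i + monom (- 1) j) = 0"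
      using ij by (simp add: poly_act_add poly_act_monom)
    ultimately show thesis by (rule that)
  next
    case True
    then have "card (?f ` {..?d}) > ?d"
      by (simp add: card_image)
    then have "dependent (?f ` {..?d})"
      using independent_bound by (meson not_le)
    then obtain u k where u: "(\<Sum>w\<in>?f ` {..?d}. u w *\<^sub>R w) = 0" and k: "k \<le> ?d" "u (?f k) \<noteq> 0"
      by (subst (asm) real_vector.dependent_finite) auto
    define p where "p = (\<Sum>k\<le>?d. monom (complex_of_real (u (?f k))) k)"
    have "coeff p k = (\<Sum>j\<le>?d. if j = k then complex_of_real (u (?f j)) else 0)"
      by (simp add: p_def coeff_sum coeff_monom)
    also have "\<dots> = complex_of_real (u (?f k))"
      using k(1) by simp
    finally have "p \<noteq> 0"
      using k(2) by auto
    moreover have "poly_act M v p = (\<Sum>k\<le>?d. u (?f k) *\<^sub>R ?f k)"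
      unfolding p_def poly_act_sum poly_act_monom
      by (intro sum.cong refl) (simp add: vec_eq_iff scaleR_conv_of_real[where 'a=complex])
    then have "poly_act M v p = 0"
      using u True by (simp add: sum.reindex)
    ultimately show thesis by (rule that)
  qed
qed

text \<open>Linear factors \<open>X - \<mu>\<close> are split off an annihilating polynomial \<open>p\<close> of \<open>v\<close>. If
  \<open>p = (X - \<mu>) q\<close>, then \<open>(M - \<mu>) q(M) v = 0\<close>, so either \<open>q(M) v\<close> is an eigenvector or \<open>q\<close> is an
  annihilating polynomial of lower degree; nonzero constants do not annihilate \<open>v \<noteq> 0\<close>. All vectors
  \<open>q(M) v\<close> stay in the invariant subspace.\<close>

lemma ex_eigenvector_in_invariant_subspace:
  fixes M :: "complex^'n^'n"
  assumes K: "vec.subspace K" and inv: "\<And>w. w \<in> K \<Longrightarrow> M *v w \<in> K"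
    and v: "v \<in> K" "v \<noteq> 0"
  obtains w \<mu> where "w \<in> K" and "w \<noteq> 0" and "M *v w = \<mu> *s w"
proof -
  have in_K: "poly_act M v q \<in> K" for q
    by (induction q) (auto intro: vec.subspace_0[OF K] vec.subspace_add[OF K] vec.subspace_scale[OF K] inv v)
  obtain p where "p \<noteq> 0" "poly_act M v p = 0"
    using ex_annihilating_poly[of M v] by blast
  then have "\<exists>q \<mu>. poly_act M v q \<noteq> 0 \<and> M *v poly_act M v q = \<mu> *s poly_act M v q"
  proof (induction "degree p" arbitrary: p rule: less_induct)
    case less
    have "degree p \<noteq> 0"
    proof
      assume "degree p = 0"
      then obtain c where "p = [:c:]" by (rule degree_eq_zeroE)
      with less.prems v show False by simp
    qed
    then have "\<not> constant (poly p)"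
      by (simp add: constant_degree)
    then obtain \<mu> where "poly p \<mu> = 0"
      using fundamental_theorem_of_algebra by blast
    then obtain q where p: "p = [:- \<mu>, 1:] * q"
      by (auto simp: poly_eq_0_iff_dvd dvd_def)
    then have "p = smult (- \<mu>) q + pCons 0 q"
      by simp
    then have "poly_act M v p = M *v poly_act M v q - \<mu> *s poly_act M v q"
      by (simp only: poly_act_add poly_act_smult poly_act_pCons) (simp add: vector_smult_lneg)
    with less.prems(2) have act: "M *v poly_act M v q = \<mu> *s poly_act M v q"
      by simp
    have "q \<noteq> 0"
      using less.prems(1) by (auto simp: p)
    then have "degree p = degree [:- \<mu>, 1:] + degree q"
      unfolding p by (intro degree_mult_eq) auto
    with less.hyps act \<open>q \<noteq> 0\<close> show ?case by fastforce
  qed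
  with in_K that show thesis by blast
qed

section \<open>Spectral mapping\<close>

lemma map_matrix_of_real_mult:
  "map_matrix complex_of_real (X ** Y) = map_matrix complex_of_real X ** map_matrix complex_of_real Y"
  by (simp add: vec_eq_iff matrix_matrix_mult_def)

lemma mittag_leffler_matrix_eigenvector:
  fixes M :: "real^'n^'n"
  assumes "\<alpha> > 0" and w: "map_matrix complex_of_real M *v w = \<mu> *s w"
  shows "map_matrix complex_of_real (mittag_leffler_matrix \<alpha> \<beta> M) *v w
    = mittag_leffler \<alpha> \<beta> \<mu> *s w"
proof -
  let ?c = "\<lambda>k. rGamma (\<alpha> * real k + \<beta>)"
  have power: "map_matrix complex_of_real (matrix_power M k) *v w = \<mu> ^ k *s w" for k
  proof (induction k)
    case 0
    have "map_matrix complex_of_real (mat 1 :: real^'n^'n) = mat 1"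
      by (simp add: vec_eq_iff mat_def)
    then show ?case by simp
  next
    case (Suc k)
    then show ?case
      by (simp add: map_matrix_of_real_mult matrix_vector_mul_assoc[symmetric]
          vector_scalar_commute w vector_smult_assoc mult.commute)
  qed
  have lin: "linear (\<lambda>X::real^'n^'n. map_matrix complex_of_real X *v w)"
    by (auto simp: linear_iff vec_eq_iff matrix_vector_mult_def distrib_right sum.distrib
        scaleR_conv_of_real[where 'a=complex] sum_distrib_left mult.assoc)
  have "(\<lambda>k. ?c k *\<^sub>R (\<mu> ^ k *s w)) sums
      (map_matrix complex_of_real (mittag_leffler_matrix \<alpha> \<beta> M) *v w)"
    using linear_mittag_leffler_matrix_sums[OF assms(1) lin, of \<beta> M] by (simp add: power)
  moreover have "(\<lambda>k. ?c k *\<^sub>R (\<mu> ^ k *s w)) sums (mittag_leffler \<alpha> \<beta> \<mu> *s w)"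
  proof -
    have "summable (\<lambda>k. ?c k *\<^sub>R \<mu> ^ k)"
      using summable_rGamma_power[OF assms(1), of \<beta> "norm \<mu>"]
      by (intro summable_norm_cancel[of "\<lambda>k. ?c k *\<^sub>R \<mu> ^ k"]) (simp add: norm_power)
    then have "(\<lambda>k. ?c k *\<^sub>R \<mu> ^ k) sums mittag_leffler \<alpha> \<beta> \<mu>"
      unfolding mittag_leffler_def by (rule summable_sums)
    moreover have "bounded_linear (\<lambda>z::complex. z *s w)"
      unfolding linear_conv_bounded_linear[symmetric]
      by (auto simp: linear_iff vec_eq_iff algebra_simps)
    ultimately have "(\<lambda>k. (?c k *\<^sub>R \<mu> ^ k) *s w) sums (mittag_leffler \<alpha> \<beta> \<mu> *s w)"
      by (rule bounded_linear.sums[rotated])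
    moreover have "(?c k *\<^sub>R \<mu> ^ k) *s w = ?c k *\<^sub>R (\<mu> ^ k *s w)" for k
      by (simp add: vec_eq_iff)
    ultimately show ?thesis by simp
  qed
  ultimately show ?thesis by (rule sums_unique2)
qed

text \<open>The complexified kernel of the matrix function is invariant under \<open>M\<close>; on an eigenvector of \<open>M\<close>
  inside it, the matrix function acts both as zero and as the scalar \<open>mittag_leffler \<alpha> \<beta> \<eta>\<close>.\<close>

lemma ex_eigenvalue_mittag_leffler_zero:
  fixes M :: "real^'n^'n"
  assumes "\<alpha> > 0" and x0: "x0 \<in> matrix_kernel (mittag_leffler_matrix \<alpha> \<beta> M)" "x0 \<noteq> 0"
  obtains \<eta> where "complex_eigenvalue M \<eta>" and "mittag_leffler \<alpha> \<beta> \<eta> = 0"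
proof -
  let ?M = "map_matrix complex_of_real M"
  let ?F = "map_matrix complex_of_real (mittag_leffler_matrix \<alpha> \<beta> M)"
  define v where "v = (\<chi> i. complex_of_real (x0 $ i))"
  have "?F *v v = (\<chi> i. complex_of_real ((mittag_leffler_matrix \<alpha> \<beta> M *v x0) $ i))"
    by (simp add: vec_eq_iff matrix_vector_mult_def v_def)
  with x0 have v: "v \<in> {w. ?F *v w = 0}" "v \<noteq> 0"
    by (auto simp: matrix_kernel_def v_def vec_eq_iff)
  have sub: "vec.subspace {w. ?F *v w = 0}"
    by (auto simp: vec.subspace_def matrix_vector_right_distrib vector_scalar_commute)
  have inv: "?M *v w \<in> {w. ?F *v w = 0}" if "w \<in> {w. ?F *v w = 0}" for w
  proof -
    have "?F *v (?M *v w) = ?M *v (?F *v w)"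
      by (simp add: matrix_vector_mul_assoc map_matrix_of_real_mult[symmetric]
          mittag_leffler_matrix_commute assms(1))
    with that show ?thesis by simp
  qed
  obtain w \<eta> where w: "?F *v w = 0" "w \<noteq> 0" "?M *v w = \<eta> *s w"
    using ex_eigenvector_in_invariant_subspace[OF sub inv v] by auto
  have "mittag_leffler \<alpha> \<beta> \<eta> = 0"
    using mittag_leffler_matrix_eigenvector[OF assms(1) w(3), of \<beta>] w by simp
  with w that show thesis
    by (auto simp: complex_eigenvalue_def)
qed

lemma complex_eigenvalue_scaleR:
  fixes A :: "real^'n^'n"
  assumes "complex_eigenvalue (s *\<^sub>R A) \<eta>" and "s \<noteq> 0"
  shows "complex_eigenvalue A (\<eta> / complex_of_real s)"
proof -
  obtain w where w: "w \<noteq> 0" "map_matrix complex_of_real (s *\<^sub>R A) *v w = \<eta> *s w"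
    using assms(1) by (auto simp: complex_eigenvalue_def)
  have "map_matrix complex_of_real (s *\<^sub>R A) *v w
      = complex_of_real s *s (map_matrix complex_of_real A *v w)"
    by (simp add: vec_eq_iff matrix_vector_mult_def sum_distrib_left mult_ac)
  with w(2) assms(2) have "map_matrix complex_of_real A *v w = (\<eta> / complex_of_real s) *s w"
    by (simp add: vec_eq_iff field_simps)
  with w(1) show ?thesis
    by (auto simp: complex_eigenvalue_def)
qed

section \<open>Multiple points of trajectories\<close>

theorem theorem7:
  fixes \<alpha> T :: real and A :: "real^'n^'n" and x0 :: "real^'n"
  assumes "0 < \<alpha>" and "\<alpha> < 1"
    and "T > 0"
    and "\<not> trajectory \<alpha> A x0 constant_on {0..}"
  shows "multiple_point (trajectory \<alpha> A x0) T (trajectory \<alpha> A x0 T) \<longleftrightarrow>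
    x0 \<in> matrix_kernel (mittag_leffler_matrix \<alpha> 0 ((T powr \<alpha>) *\<^sub>R A)) \<and>
    (\<exists>\<mu> \<eta>. complex_eigenvalue A \<mu> \<and> mittag_leffler \<alpha> 0 \<eta> = 0 \<and>
      \<mu> = \<eta> / complex_of_real (T powr \<alpha>))"
proof -
  let ?M = "(T powr \<alpha>) *\<^sub>R A"
  let ?F = "mittag_leffler_matrix \<alpha> 0 ?M"
  have deriv: "(trajectory \<alpha> A x0 has_vector_derivative (1 / T) *\<^sub>R (?F *v x0)) (at T)"
    by (rule trajectory_has_vector_derivative) fact+
  have "(trajectory \<alpha> A x0 has_vector_derivative 0) (at T) \<longleftrightarrow> (1 / T) *\<^sub>R (?F *v x0) = 0"
    using deriv by (auto dest: vector_derivative_unique_at)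
  then have multiple: "multiple_point (trajectory \<alpha> A x0) T (trajectory \<alpha> A x0 T) \<longleftrightarrow>
      x0 \<in> matrix_kernel ?F"
    using assms by (simp add: multiple_point_def matrix_kernel_def)
  have "x0 \<noteq> 0"
  proof
    assume "x0 = 0"
    then have "trajectory \<alpha> A x0 constant_on {0..}"
      by (simp add: constant_on_def trajectory_def)
    with assms(4) show False ..
  qed
  moreover have "T powr \<alpha> \<noteq> 0"
    using assms(3) by simp
  ultimately have "\<exists>\<mu> \<eta>. complex_eigenvalue A \<mu> \<and> mittag_leffler \<alpha> 0 \<eta> = 0 \<and>
      \<mu> = \<eta> / complex_of_real (T powr \<alpha>)" if "x0 \<in> matrix_kernel ?F"
    using ex_eigenvalue_mittag_leffler_zero[OF assms(1) that] complex_eigenvalue_scaleR by metis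
  with multiple show ?thesis by blast
qed

end
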